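(* Let $(I,+,\preceq_I,\ast)$ be a partially ordered commutative ring. Let $x_1,\dots,x_5\in I$ with $x_i\succeq_I x_{i+1}$ for $1\leq i\leq 4$ and $x_1+x_4\succeq_I x_2+x_3$, and let $n\geq 0$ be an integer. Let $a_1,\dots,a_5\in I$ and suppose that for each $i\in\{2,4\}$ there is an upper bound $\hat a_i\in I$ of $\{a_i,-a_i\}$ such that $a_1\succeq_I\hat a_2\succeq_I a_3\succeq_I 0$ and such that either $a_3+a_5\succeq_I\hat a_4\succeq_I a_5\succeq_I 0$ or $a_5\succeq_I\hat a_4\succeq_I 0$. Then $$\sum_{i=1}^5 a_i\ast\prod_{\substack{1\leq j\leq 5\\ j\neq i}}(x_i-x_j)^n\succeq_I 0,$$ where the product is taken with respect to $\ast$.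
   Context: A partially ordered Abelian group $(I,+,\preceq_I)$ is an Abelian group with a partial order such that $x+z\preceq_I y+z\Leftrightarrow x\preceq_I y$ for all $x,y,z\in I$. A partially ordered commutative ring $(I,+,\preceq_I,\ast)$ is a partially ordered Abelian group together with an operation $\ast:I\times I\to I$ that is associative, commutative, distributive over $+$, nonnegativity-preserving ($x\succeq_I 0$ and $y\succeq_I 0$ imply $x\ast y\succeq_I 0$), and has an identity element in $I$. Powers $x^n$ are with respect to $\ast$. An element $u$ is an upper bound of $S\subset I$ if $u\succeq_I s$ for all $s\in S$. *)

theory Defs
  imports Main
begin

(* The trivial ring (0 = 1) is allowed, so the class is not built on comm_ring_1.
   The order is partial, and 0 \<le> 1 is not assumed. *)
class partially_ordered_comm_ring = comm_ring + comm_monoid_mult + ordered_ab_group_add +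
  assumes times_nonneg: "0 \<le> x \<Longrightarrow> 0 \<le> y \<Longrightarrow> 0 \<le> x * y"
begin

subclass ordered_comm_ring
proof
  fix a b c :: 'a
  assume "a \<le> b" "0 \<le> c"
  then have "0 \<le> c * (b - a)"
    by (intro times_nonneg) simp_all
  then show "c * a \<le> c * b"
    by (simp add: right_diff_distrib)
qed

end

end

theory Submission
  imports Defs
begin

text \<open>
  Write \<open>P\<^sub>i\<close> for the product of the \<open>\<bar>x\<^sub>i - x\<^sub>j\<bar>\<close>, \<open>j \<noteq> i\<close>. Since \<open>a\<^sub>2\<close> and \<open>a\<^sub>4\<close> enter
  only through their bounds \<open>c\<^sub>2\<close> and \<open>c\<^sub>4\<close>, the sum dominates
  \<open>a\<^sub>1 P\<^sub>1\<^sup>n - c\<^sub>2 P\<^sub>2\<^sup>n + a\<^sub>3 P\<^sub>3\<^sup>n - c\<^sub>4 P\<^sub>4\<^sup>n + a\<^sub>5 P\<^sub>5\<^sup>n\<close> for every parity of \<open>n\<close>.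
  By Abel summation this is a nonnegative combination of the \<open>P\<^sub>i\<^sup>n\<close>, \<open>P\<^sub>1\<^sup>n - P\<^sub>2\<^sup>n\<close>, \<open>P\<^sub>5\<^sup>n - P\<^sub>4\<^sup>n\<close> and
  \<open>P\<^sub>1\<^sup>n - P\<^sub>2\<^sup>n + P\<^sub>3\<^sup>n - P\<^sub>4\<^sup>n\<close>. The last expression is nonnegative for \<open>n = 1\<close> by the
  hypothesis \<open>x\<^sub>1 + x\<^sub>4 \<ge> x\<^sub>2 + x\<^sub>3\<close>, and then for all \<open>n \<ge> 1\<close> by induction, using
  \<open>P\<^sub>1 \<ge> P\<^sub>4\<close> and \<open>P\<^sub>1 \<ge> P\<^sub>2 \<ge> P\<^sub>3\<close>. The case \<open>n = 0\<close> is separate because \<open>0 \<le> 1\<close> may fail.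
\<close>

lemma power_nonneg_pos_exponent:
  fixes p :: "'a :: partially_ordered_comm_ring"
  assumes "0 < n" "0 \<le> p"
  shows "0 \<le> p ^ n"
  using assms by (induction n rule: nat_induct_non_zero) (simp_all add: times_nonneg)

lemma power_mono_pos_exponent:
  fixes p q :: "'a :: partially_ordered_comm_ring"
  assumes "0 < n" "0 \<le> p" "p \<le> q"
  shows "p ^ n \<le> q ^ n"
  using assms(1)
proof (induction n rule: nat_induct_non_zero)
  case 1
  then show ?case using assms by simp
next
  case (Suc n)
  have "0 \<le> q" using assms by (rule_tac order_trans)
  moreover have "0 \<le> p ^ n" using Suc assms by (simp add: power_nonneg_pos_exponent)
  ultimately show ?case using Suc assms by (simp add: mult_mono)
qed

lemma power_diff_mono_pos_exponent:
  fixes p q r s :: "'a :: partially_ordered_comm_ring"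
  assumes n: "0 < n"
    and ord: "0 \<le> r" "r \<le> q" "q \<le> p" "0 \<le> s" "s \<le> p"
    and diff: "s - r \<le> p - q"
  shows "s ^ n - r ^ n \<le> p ^ n - q ^ n"
  using n
proof (induction n rule: nat_induct_non_zero)
  case 1
  then show ?case using diff by simp
next
  case (Suc n)
  have q: "0 \<le> q" using ord by (rule_tac order_trans)
  have "0 \<le> p ^ n - q ^ n"
    using power_mono_pos_exponent[OF Suc(1) q ord(3)] by simp
  moreover have "0 \<le> q ^ n - r ^ n"
    using power_mono_pos_exponent[OF Suc(1) ord(1,2)] by simp
  moreover have "0 \<le> r ^ n" using Suc(1) ord by (simp add: power_nonneg_pos_exponent)
  \<comment> \<open>Obtained from \<open>p ^ Suc n - q ^ Suc n = p * (p ^ n - q ^ n) + q ^ n * (p -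
    q)\<close> and its analogue for \<open>s\<close>, \<open>r\<close>, comparing the two halves
    separately.\<close>
  ultimately have "0 \<le> (p - s) * (p ^ n - q ^ n) + s * ((p ^ n - q ^ n) - (s ^ n - r ^ n))
      + (q ^ n - r ^ n) * (p - q) + r ^ n * ((p - q) - (s - r))"
    using ord diff Suc.IH by (intro add_nonneg_nonneg times_nonneg) simp_all
  also have "\<dots> = (p ^ Suc n - q ^ Suc n) - (s ^ Suc n - r ^ Suc n)"
    by (simp add: algebra_simps)
  finally show ?case by simp
qed

lemma power_uminus_cases:
  fixes p :: "'a :: partially_ordered_comm_ring"
  shows "(- p) ^ n = p ^ n \<or> (- p) ^ n = - (p ^ n)"
  by (induction n) auto

text \<open>The parity of \<open>n\<close> only decides the sign in front of \<open>p ^ n\<close>,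
  and \<open>c\<close> bounds both \<open>a\<close> and \<open>- a\<close>.\<close>

lemma mult_power_uminus_ge:
  fixes a c p :: "'a :: partially_ordered_comm_ring"
  assumes "0 < n" "0 \<le> p" "a \<le> c" "- a \<le> c"
  shows "- (c * p ^ n) \<le> a * (- p) ^ n"
proof -
  have p: "0 \<le> p ^ n" using assms by (simp add: power_nonneg_pos_exponent)
  have "a * p ^ n \<le> c * p ^ n" "- a * p ^ n \<le> c * p ^ n"
    by (rule mult_right_mono[OF assms(3) p], rule mult_right_mono[OF assms(4) p])
  then have "- (c * p ^ n) \<le> - (a * p ^ n)" "- (c * p ^ n) \<le> a * p ^ n"
    by (simp, subst minus_le_iff, simp)
  then show ?thesis using power_uminus_cases[of p n] by auto
qed

text \<open>With \<open>dk\<close> the gap between the points k and k+1, this is the case n = 1 of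
  the four-term inequality.\<close>

lemma gap_product_difference:
  fixes d1 d2 d3 d4 :: "'a :: partially_ordered_comm_ring"
  assumes d: "0 \<le> d1" "0 \<le> d2" "0 \<le> d3" "0 \<le> d4" "d3 \<le> d1"
  shows "(d1 + d2 + d3) * (d2 + d3) * d3 * d4 - (d1 + d2) * d2 * d3 * (d3 + d4)
    \<le> d1 * (d1 + d2) * (d1 + d2 + d3) * (d1 + d2 + d3 + d4) - d1 * d2 * (d2 + d3) * (d2 + d3 + d4)"
    (is "?l \<le> ?r")
proof -
  let ?t = "d1 + d2 + d3"
  \<comment> \<open>The first summand collects the terms containing \<open>d4\<close>; only it uses
    \<open>d3 \<le> d1\<close>. The others come from
    \<open>?t * ?t - (d2 + d3) * (d2 + d3) = d1 * (?t + d2 + d3)\<close>.\<close>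
  have "0 \<le> (d1 - d3) * d4 * (d1 + d3) * (?t + d2)
      + d1 * d1 * (?t * ?t + d2 * (?t + d2 + d3)) + d2 * (d1 + d2) * d3 * d3"
    using d by (intro add_nonneg_nonneg times_nonneg) simp_all
  also have "\<dots> = ?r - ?l" by (simp add: algebra_simps)
  finally show ?thesis by simp
qed

lemma weighted_sum_nonneg:
  fixes a1 a3 a5 c2 c4 :: "'a :: partially_ordered_comm_ring"
  assumes p: "0 \<le> p1" "0 \<le> p3" "0 \<le> p4" "0 \<le> p5" "p2 \<le> p1" "p4 \<le> p5" "p4 - p3 \<le> p1 - p2"
    and a: "c2 \<le> a1" "a3 \<le> c2" "0 \<le> a3"
    and c4: "(c4 \<le> a3 + a5 \<and> a5 \<le> c4 \<and> 0 \<le> a5) \<or> (c4 \<le> a5 \<and> 0 \<le> c4)"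
  shows "0 \<le> a1 * p1 - c2 * p2 + a3 * p3 - c4 * p4 + a5 * p5"
  using c4
proof
  assume c: "c4 \<le> a3 + a5 \<and> a5 \<le> c4 \<and> 0 \<le> a5"
  \<comment> \<open>Of the weight \<open>c4\<close> on \<open>p4\<close>, a share \<open>a3\<close>
    is absorbed by the four-term difference and a share \<open>a5\<close> by
    \<open>p5 - p4\<close>.\<close>
  have "0 \<le> (a1 - c2) * p1 + (c2 - a3) * (p1 - p2) + a3 * ((p1 - p2) - (p4 - p3))
      + (a3 + a5 - c4) * p4 + a5 * (p5 - p4)"
    using p a c by (intro add_nonneg_nonneg times_nonneg) simp_all
  also have "\<dots> = a1 * p1 - c2 * p2 + a3 * p3 - c4 * p4 + a5 * p5"
    by (simp add: algebra_simps)
  finally show ?thesis .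
next
  assume c: "c4 \<le> a5 \<and> 0 \<le> c4"
  \<comment> \<open>Here \<open>a5\<close> alone covers \<open>c4\<close>, so \<open>p2\<close> is
    paired with \<open>p1\<close> and \<open>p4\<close> with \<open>p5\<close>.\<close>
  have "0 \<le> c2" using a(3,2) by (rule order_trans)
  then have "0 \<le> (a1 - c2) * p1 + c2 * (p1 - p2) + a3 * p3 + (a5 - c4) * p5 + c4 * (p5 - p4)"
    using p a c by (intro add_nonneg_nonneg times_nonneg) simp_all
  also have "\<dots> = a1 * p1 - c2 * p2 + a3 * p3 - c4 * p4 + a5 * p5"
    by (simp add: algebra_simps)
  finally show ?thesis .
qed

lemma five_point_gap_inequality:
  fixes d1 d2 d3 d4 :: "'a :: partially_ordered_comm_ring"
  defines "P1 \<equiv> d1 * (d1 + d2) * (d1 + d2 + d3) * (d1 + d2 + d3 + d4)"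
    and "P2 \<equiv> d1 * d2 * (d2 + d3) * (d2 + d3 + d4)"
    and "P3 \<equiv> (d1 + d2) * d2 * d3 * (d3 + d4)"
    and "P4 \<equiv> (d1 + d2 + d3) * (d2 + d3) * d3 * d4"
    and "P5 \<equiv> (d1 + d2 + d3 + d4) * (d2 + d3 + d4) * (d3 + d4) * d4"
  assumes n: "0 < n"
    and d: "0 \<le> d1" "0 \<le> d2" "0 \<le> d3" "0 \<le> d4" "d3 \<le> d1"
    and a2: "a2 \<le> c2" "- a2 \<le> c2"
    and a4: "a4 \<le> c4" "- a4 \<le> c4"
    and a: "c2 \<le> a1" "a3 \<le> c2" "0 \<le> a3"
    and c4: "(c4 \<le> a3 + a5 \<and> a5 \<le> c4 \<and> 0 \<le> a5) \<or> (c4 \<le> a5 \<and> 0 \<le> c4)"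
  shows "0 \<le> a1 * P1 ^ n + a2 * (- P2) ^ n + a3 * P3 ^ n + a4 * (- P4) ^ n + a5 * P5 ^ n"
proof -
  have nonneg: "0 \<le> P1" "0 \<le> P2" "0 \<le> P3" "0 \<le> P4" "0 \<le> P5"
    unfolding P1_def P2_def P3_def P4_def P5_def
    using d by (auto intro!: times_nonneg add_nonneg_nonneg)
  have "0 \<le> d1 * (d1 * (d1 + d2 + d3) * (d1 + d2 + d3 + d4)
      + d2 * (d1 * (d1 + d2 + d3 + d4) + (d2 + d3) * d1))"
    using d by (intro times_nonneg add_nonneg_nonneg)
  also have "\<dots> = P1 - P2" unfolding P1_def P2_def by (simp add: algebra_simps)
  finally have P21: "P2 \<le> P1" by simp
  \<comment> \<open>Uses \<open>d1 * (d2 + d3) - (d1 + d2) * d3 = d2 * (d1 - d3)\<close>.\<close>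
  have "0 \<le> d2 * (d2 * (d1 - d3) * (d2 + d3 + d4) + (d1 + d2) * d3 * d2)"
    using d by (intro times_nonneg add_nonneg_nonneg) simp_all
  also have "\<dots> = P2 - P3" unfolding P2_def P3_def by (simp add: algebra_simps)
  finally have P32: "P3 \<le> P2" by simp
  \<comment> \<open>Uses
    \<open>d1 * (d1 + d2) - (d2 + d3) * d3 = (d1 - d3) * (d1 + d2 + d3)\<close>.\<close>
  have "0 \<le> (d1 + d2 + d3) * (d1 * (d1 + d2) * (d1 + d2 + d3) + (d1 - d3) * (d1 + d2 + d3) * d4)"
    using d by (intro times_nonneg add_nonneg_nonneg) simp_all
  also have "\<dots> = P1 - P4" unfolding P1_def P4_def by (simp add: algebra_simps)
  finally have P41: "P4 \<le> P1" by simp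
  \<comment> \<open>Telescoping: the first three factors of \<open>P4\<close> are enlarged by
    \<open>d4\<close> one at a time to reach \<open>P5\<close>.\<close>
  have "0 \<le> d4 * ((d1 + d2 + d3) * (d2 + d3) * d4 + (d1 + d2 + d3) * d4 * (d3 + d4)
      + d4 * (d2 + d3 + d4) * (d3 + d4))"
    using d by (intro times_nonneg add_nonneg_nonneg)
  also have "\<dots> = P5 - P4" unfolding P5_def P4_def by (simp add: algebra_simps)
  finally have P45: "P4 \<le> P5" by simp
  have "P4 - P3 \<le> P1 - P2"
    unfolding P1_def P2_def P3_def P4_def using d by (rule gap_product_difference)
  then have "P4 ^ n - P3 ^ n \<le> P1 ^ n - P2 ^ n"
    using n nonneg P21 P32 P41 by (intro power_diff_mono_pos_exponent)
  moreover have "P2 ^ n \<le> P1 ^ n" "P4 ^ n \<le> P5 ^ n"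
    using n nonneg P21 P45 by (auto intro: power_mono_pos_exponent)
  ultimately have "0 \<le> a1 * P1 ^ n - c2 * P2 ^ n + a3 * P3 ^ n - c4 * P4 ^ n + a5 * P5 ^ n"
    using n nonneg a c4 by (intro weighted_sum_nonneg) (auto intro: power_nonneg_pos_exponent)
  also have "\<dots> = a1 * P1 ^ n + - (c2 * P2 ^ n) + a3 * P3 ^ n + - (c4 * P4 ^ n) + a5 * P5 ^ n"
    by simp
  also have "\<dots> \<le> a1 * P1 ^ n + a2 * (- P2) ^ n + a3 * P3 ^ n + a4 * (- P4) ^ n + a5 * P5 ^ n"
    using n nonneg a2 a4 by (intro add_mono mult_power_uminus_ge order_refl)
  finally show ?thesis .
qed

theorem theorem12:
  fixes x a a_hat :: "nat \<Rightarrow> 'a :: partially_ordered_comm_ring"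
    and n :: nat
  assumes x_decreasing: "\<forall>i\<in>{1..4}. x (i + 1) \<le> x i"
    and x_sum: "x 2 + x 3 \<le> x 1 + x 4"
    and upper_bound: "\<forall>i\<in>{2, 4}. \<forall>s\<in>{a i, - a i}. s \<le> a_hat i"
    and a_1_ge: "a_hat 2 \<le> a 1"
    and a_hat_2_ge: "a 3 \<le> a_hat 2"
    and a_3_nonneg: "0 \<le> a 3"
    and a_hat_4: "(a_hat 4 \<le> a 3 + a 5 \<and> a 5 \<le> a_hat 4 \<and> 0 \<le> a 5) \<or> (a_hat 4 \<le> a 5 \<and> 0 \<le> a_hat 4)"
  shows "0 \<le> (\<Sum>i\<in>{1..5}. a i * (\<Prod>j\<in>{1..5} - {i}. (x i - x j) ^ n))"
proof -
  have expand: "(\<Sum>i\<in>{1..5}. f i) = f 1 + f 2 + f 3 + f 4 + f 5" for f :: "nat \<Rightarrow> 'a"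
  proof -
    have I: "{1..5} = {1, 2, 3, 4, 5 :: nat}" by auto
    show ?thesis unfolding I by (simp add: add.assoc)
  qed
  have x_le: "x 2 \<le> x 1" "x 3 \<le> x 2" "x 4 \<le> x 3" "x 5 \<le> x 4"
    using x_decreasing[rule_format, of 1] x_decreasing[rule_format, of 2]
      x_decreasing[rule_format, of 3] x_decreasing[rule_format, of 4]
    by (simp_all add: numeral_eq_Suc)
  have bd: "a 2 \<le> a_hat 2" "- a 2 \<le> a_hat 2" "a 4 \<le> a_hat 4" "- a 4 \<le> a_hat 4"
    using upper_bound by auto
  show ?thesis
  proof (cases "n = 0")
    case True
    \<comment> \<open>All products are 1 here, so the coefficients themselves are summed, grouped as
      (\<open>a 1\<close>, \<open>a 2\<close>) and (\<open>a 3\<close>, \<open>a 4\<close>,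
      \<open>a 5\<close>).\<close>
    have "0 \<le> a 1 - - a 2"
      using order_trans[OF bd(2) a_1_ge] by (simp only: diff_ge_0_iff_ge)
    then have "0 \<le> a 1 + a 2" by simp
    moreover have "0 \<le> a 3 + a 4 + a 5"
    proof -
      have "- a 4 \<le> a 3 + a 5"
        using a_hat_4
      proof
        assume "a_hat 4 \<le> a 3 + a 5 \<and> a 5 \<le> a_hat 4 \<and> 0 \<le> a 5"
        then show ?thesis using bd(4) by (blast intro: order_trans)
      next
        assume "a_hat 4 \<le> a 5 \<and> 0 \<le> a_hat 4"
        then show ?thesis using bd(4) a_3_nonneg
          by (metis add_increasing order_trans)
      qed
      then have "0 \<le> a 3 + a 5 - - a 4" by (simp only: diff_ge_0_iff_ge)
      then show ?thesis by (simp add: ac_simps)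
    qed
    ultimately have "0 \<le> (a 1 + a 2) + (a 3 + a 4 + a 5)" by (rule add_nonneg_nonneg)
    then show ?thesis unfolding expand using True by (simp add: add.assoc)
  next
    case False
    define d1 d2 d3 d4 where d_defs: "d1 = x 1 - x 2" "d2 = x 2 - x 3" "d3 = x 3 - x 4" "d4 = x 4 - x 5"
    have "0 \<le> (x 1 + x 4) - (x 2 + x 3)" using x_sum by simp
    also have "\<dots> = d1 - d3" by (simp add: d_defs algebra_simps)
    finally have d31: "d3 \<le> d1" by simp
    have d: "0 \<le> d1" "0 \<le> d2" "0 \<le> d3" "0 \<le> d4" using x_le by (simp_all add: d_defs)
    have diffs: "x 1 - x 2 = d1" "x 1 - x 3 = d1 + d2" "x 1 - x 4 = d1 + d2 + d3"
      "x 1 - x 5 = d1 + d2 + d3 + d4" "x 2 - x 3 = d2" "x 2 - x 4 = d2 + d3"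
      "x 2 - x 5 = d2 + d3 + d4" "x 3 - x 4 = d3" "x 3 - x 5 = d3 + d4" "x 4 - x 5 = d4"
      "x 2 - x 1 = - d1" "x 3 - x 1 = - (d1 + d2)" "x 4 - x 1 = - (d1 + d2 + d3)"
      "x 5 - x 1 = - (d1 + d2 + d3 + d4)" "x 3 - x 2 = - d2" "x 4 - x 2 = - (d2 + d3)"
      "x 5 - x 2 = - (d2 + d3 + d4)" "x 4 - x 3 = - d3" "x 5 - x 3 = - (d3 + d4)" "x 5 - x 4 = - d4"
      by (simp_all add: d_defs)
    have erase: "{1..5} - {1} = {2, 3, 4, 5 :: nat}" "{1..5} - {2} = {1, 3, 4, 5 :: nat}"
      "{1..5} - {3} = {1, 2, 4, 5 :: nat}" "{1..5} - {4} = {1, 2, 3, 5 :: nat}"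
      "{1..5} - {5} = {1, 2, 3, 4 :: nat}"
      by auto
    \<comment> \<open>The points \<open>x 2\<close> and \<open>x 4\<close> have one and three
      larger-indexed-first differences reversed, an odd number, which leaves a minus sign; for the
      other points the signs cancel.\<close>
    have prods:
      "(\<Prod>j\<in>{1..5} - {1}. (x 1 - x j) ^ n) = (d1 * (d1 + d2) * (d1 + d2 + d3) * (d1 + d2 + d3 + d4)) ^ n"
      "(\<Prod>j\<in>{1..5} - {2}. (x 2 - x j) ^ n) = (- (d1 * d2 * (d2 + d3) * (d2 + d3 + d4))) ^ n"
      "(\<Prod>j\<in>{1..5} - {3}. (x 3 - x j) ^ n) = ((d1 + d2) * d2 * d3 * (d3 + d4)) ^ n"
      "(\<Prod>j\<in>{1..5} - {4}. (x 4 - x j) ^ n) = (- ((d1 + d2 + d3) * (d2 + d3) * d3 * d4)) ^ n"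
      "(\<Prod>j\<in>{1..5} - {5}. (x 5 - x j) ^ n) = ((d1 + d2 + d3 + d4) * (d2 + d3 + d4) * (d3 + d4) * d4) ^ n"
      unfolding erase
      by (simp_all add: diffs power_mult_distrib[symmetric] mult.assoc
          del: minus_add_distrib One_nat_def)
    show ?thesis
      unfolding expand prods using False d d31 bd a_1_ge a_hat_2_ge a_3_nonneg a_hat_4
      by (intro five_point_gap_inequality[where ?c2.0 = "a_hat 2" and ?c4.0 = "a_hat 4"]) simp_all
  qed
qed

end
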